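(* Let $$\bm W=\begin{bmatrix}1\\1\\-1\\-1\end{bmatrix},\quad \bm H=\begin{bmatrix}1&2&1\\1&-2&3\\2&-2&2\\-1&2&3\end{bmatrix},\quad \bm b=\bm 0\in\mathbb{R}^4,$$ $$\Xi=\mathrm{conv}\{\bm 0,\bm p_1,\ldots,\bm p_7\}\subset\mathbb{R}^3,\quad \bm p_j=[\cos\theta_j,\ \sin\theta_j,\ 1]^\top,\quad \theta_j=\tfrac{2\pi(j-1)}{7},$$ and let $\mathbb{P}$ be any distribution supported on $\Xi$ with $\mathbb{E}[\|\tilde{\bm\xi}\|]<\infty$, where $\tilde{\bm\xi}\sim\mathbb{P}$. Let $n\geq 1$ and $\bm c\in\mathbb{R}^n$, and consider the two-stage stochastic linear program $$\min_{\bm x\in\mathbb{R}^n}\ \bm c^\top\bm x+\mathbb{E}\Big[\min_{y\in\mathbb{R}}\{0:\ \bm T\bm x+\bar{\bm W}y\ge\bm h(\tilde{\bm\xi})\}\Big],$$ where $$\bm T=\begin{bmatrix}\bm I\\-\bm I\\\bm O\end{bmatrix}\in\mathbb{R}^{(2n+4)\times n},\quad \bar{\bm W}=\begin{bmatrix}\bm O\\-\bm O\\\bm W\end{bmatrix}\in\mathbb{R}^{(2n+4)\times1},\quad \bm h(\bm\xi)=\begin{bmatrix}\bm e\\-\bm e\\\bm b-\bm H\bm\xi\end{bmatrix}\ \ \forall\bm\xi\in\Xi,$$ with $\bm I$ the $n\times n$ identity, $\bm O$ zero matrices of appropriate size, and $\bm e\in\mathbb{R}^n$ the all-ones vector. Then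 this problem satisfies the assumptions A2, A3 and A4a given in the context, but violates A4b. Consequently, A4b is not implied by A2, A3 and A4a.
   Context: For a two-stage stochastic linear program $$v^\star=\min_{\bm x\in\mathbb{R}^n}\ \bm c^\top\bm x+\mathbb{E}[Q(\bm x,\tilde{\bm\xi})],\qquad Q(\bm x,\bm\xi)=\min_{\bm y\in\mathbb{R}^r}\{\bm q^\top\bm y:\ \bm T\bm x+\bar{\bm W}\bm y\ge\bm h(\bm\xi)\},$$ with $\bm h$ affine, $\tilde{\bm\xi}$ supported on a polyhedron $\Xi\subset\mathbb{R}^d$, and $Q=+\infty$ when the inner problem is infeasible, the assumptions are: A2: $v^\star$ is finite and $\mathbb{E}[\|\tilde{\bm\xi}\|]<\infty$. A3: the set of optimal first-stage decisions $\bm x$ is nonempty and bounded. A4a: there exists $\bm x\in\mathbb{R}^n$ such that $Q(\bm x,\bm\zeta)<\infty$ for all $\bm\zeta\in\Xi$. A4b: for the same $\bm x$ as in A4a and for some $\epsilon>0$, at every vertex $\bm\zeta_0$ of $\Xi$ there exists an affine function $\bm y_{\bm\zeta_0}:\mathbb{R}^d\to\mathbb{R}^r$ such that $\bm T\bm x+\bar{\bm W}\bm y_{\bm\zeta_0}(\bm\zeta)\ge\bm h(\bm\zeta)$ for all $\bm\zeta\in\Xi\cap B(\bm\zeta_0,\epsilon)$, where $B(\bm\zeta_0,\epsilon)$ is the ball of radius $\epsilon$ centered at $\bm\zeta_0$. Violating A4b means that no $\bm x$ satisfying the requirement in A4a satisfies the requirement in A4b. In the program of the claim, $r=1$, $d=3$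 and $\bm q=0$. *)

theory Defs
  imports "HOL-Probability.Probability"
begin

definition affine_map :: "('a::real_vector \<Rightarrow> 'b::real_vector) \<Rightarrow> bool" where
  "affine_map f \<longleftrightarrow> (\<exists>g a. linear g \<and> (\<forall>x. f x = g x + a))"

text \<open>The uncertain parameter is represented by its law, a Borel measure on \<^typ>\<open>real^'d\<close>.
  The inequality between vectors below is the library's componentwise order.\<close>

record ('n, 'r, 'd, 'm) two_stage_lp =
  first_cost  :: "real^'n"
  second_cost :: "real^'r"
  tech_mat    :: "real^'n^'m"
  recourse_mat :: "real^'r^'m"
  rhs         :: "real^'d \<Rightarrow> real^'m"
  unc_set     :: "(real^'d) set"
  law         :: "(real^'d) measure"

definition two_stage_slp :: "('n::finite, 'r::finite, 'd::finite, 'm::finite) two_stage_lp \<Rightarrow> bool" where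
  "two_stage_slp S \<longleftrightarrow>
     affine_map (rhs S) \<and> polyhedron (unc_set S) \<and>
     prob_space (law S) \<and> sets (law S) = sets borel \<and>
     (AE \<xi> in law S. \<xi> \<in> unc_set S)"

definition recourse_feasible ::
  "('n::finite, 'r::finite, 'd::finite, 'm::finite) two_stage_lp \<Rightarrow> real^'n \<Rightarrow> real^'d \<Rightarrow> real^'r \<Rightarrow> bool" where
  "recourse_feasible S x \<xi> y \<longleftrightarrow> tech_mat S *v x + recourse_mat S *v y \<ge> rhs S \<xi>"

text \<open>The infimum of the empty set in \<^typ>\<open>ereal\<close> is \<open>\<infinity>\<close>, so the value is \<open>\<infinity>\<close> exactly
  when the inner problem is infeasible.\<close>

definition recourse_value ::
  "('n::finite, 'r::finite, 'd::finite, 'm::finite) two_stage_lp \<Rightarrow> real^'n \<Rightarrow> real^'d \<Rightarrow> ereal" where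
  "recourse_value S x \<xi> = (INF y \<in> {y. recourse_feasible S x \<xi> y}. ereal (second_cost S \<bullet> y))"

text \<open>Expectation of an extended-real function, as positive part minus negative part
  (\<^const>\<open>e2ennreal\<close> truncates negative values to 0). The case \<open>\<infinity> - \<infinity>\<close> evaluates to \<open>\<infinity>\<close>
  in \<^typ>\<open>ereal\<close>, the usual convention for minimization.\<close>

definition ereal_expectation :: "'a measure \<Rightarrow> ('a \<Rightarrow> ereal) \<Rightarrow> ereal" where
  "ereal_expectation M f =
     enn2ereal (\<integral>\<^sup>+ x. e2ennreal (f x) \<partial>M) - enn2ereal (\<integral>\<^sup>+ x. e2ennreal (- f x) \<partial>M)"

definition objective ::
  "('n::finite, 'r::finite, 'd::finite, 'm::finite) two_stage_lp \<Rightarrow> real^'n \<Rightarrow> ereal" where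
  "objective S x = ereal (first_cost S \<bullet> x) + ereal_expectation (law S) (recourse_value S x)"

definition optimal_value :: "('n::finite, 'r::finite, 'd::finite, 'm::finite) two_stage_lp \<Rightarrow> ereal" where
  "optimal_value S = (INF x. objective S x)"

text \<open>A point of infinite objective value is infeasible and never counts as optimal.\<close>

definition optimal_decisions ::
  "('n::finite, 'r::finite, 'd::finite, 'm::finite) two_stage_lp \<Rightarrow> (real^'n) set" where
  "optimal_decisions S = {x. objective S x < \<infinity> \<and> objective S x = optimal_value S}"

definition A2 :: "('n::finite, 'r::finite, 'd::finite, 'm::finite) two_stage_lp \<Rightarrow> bool" where
  "A2 S \<longleftrightarrow> \<bar>optimal_value S\<bar> \<noteq> \<infinity> \<and> integrable (law S) norm"

definition A3 :: "('n::finite, 'r::finite, 'd::finite, 'm::finite) two_stage_lp \<Rightarrow> bool" where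
  "A3 S \<longleftrightarrow> optimal_decisions S \<noteq> {} \<and> bounded (optimal_decisions S)"

definition A4a_at ::
  "('n::finite, 'r::finite, 'd::finite, 'm::finite) two_stage_lp \<Rightarrow> real^'n \<Rightarrow> bool" where
  "A4a_at S x \<longleftrightarrow> (\<forall>\<zeta>\<in>unc_set S. recourse_value S x \<zeta> < \<infinity>)"

definition A4a :: "('n::finite, 'r::finite, 'd::finite, 'm::finite) two_stage_lp \<Rightarrow> bool" where
  "A4a S \<longleftrightarrow> (\<exists>x. A4a_at S x)"

definition A4b_at ::
  "('n::finite, 'r::finite, 'd::finite, 'm::finite) two_stage_lp \<Rightarrow> real^'n \<Rightarrow> bool" where
  "A4b_at S x \<longleftrightarrow>
     (\<exists>\<epsilon>>0. \<forall>\<zeta>\<^sub>0. \<zeta>\<^sub>0 extreme_point_of unc_set S \<longrightarrow>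
        (\<exists>y. affine_map y \<and>
             (\<forall>\<zeta> \<in> unc_set S \<inter> ball \<zeta>\<^sub>0 \<epsilon>. recourse_feasible S x \<zeta> (y \<zeta>))))"

text \<open>The same first-stage decision has to serve for both requirements.\<close>

definition A4b :: "('n::finite, 'r::finite, 'd::finite, 'm::finite) two_stage_lp \<Rightarrow> bool" where
  "A4b S \<longleftrightarrow> (\<exists>x. A4a_at S x \<and> A4b_at S x)"

definition W_ex :: "real^1^4" where
  "W_ex = vector [vector [1], vector [1], vector [-1], vector [-1]]"

definition H_ex :: "real^3^4" where
  "H_ex = vector [vector [ 1,  2, 1],
                  vector [ 1, -2, 3],
                  vector [ 2, -2, 2],
                  vector [-1,  2, 3]]"

definition b_ex :: "real^4" where
  "b_ex = 0"

definition \<theta>_ex :: "nat \<Rightarrow> real" where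
  "\<theta>_ex j = 2 * pi * (real j - 1) / 7"

definition p_ex :: "nat \<Rightarrow> real^3" where
  "p_ex j = vector [cos (\<theta>_ex j), sin (\<theta>_ex j), 1]"

definition \<Xi>_ex :: "(real^3) set" where
  "\<Xi>_ex = convex hull (insert 0 (p_ex ` {1..7}))"

text \<open>Vertical stacking of three blocks; applied to matrices, whose entries along the row index
  are row vectors, it gives a block matrix. The row index type \<open>'n + 'n + 4\<close> has \<open>2n + 4\<close> elements.\<close>

definition stack3 :: "'a^'k::finite \<Rightarrow> 'a^'l::finite \<Rightarrow> 'a^'m::finite \<Rightarrow> 'a^('k + 'l + 'm)" where
  "stack3 u v w = (\<chi> i. case i of Inl k \<Rightarrow> u $ k | Inr (Inl l) \<Rightarrow> v $ l | Inr (Inr m) \<Rightarrow> w $ m)"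

text \<open>In \<open>rhs\<close>, \<open>1\<close> is the all-ones vector, whereas \<open>mat 1\<close> in \<open>tech_mat\<close> is the identity matrix.\<close>

definition example_slp ::
  "real^'n \<Rightarrow> (real^3) measure \<Rightarrow> ('n::finite, 1, 3, 'n + 'n + 4) two_stage_lp" where
  "example_slp c P = \<lparr>
     first_cost = c,
     second_cost = 0,
     tech_mat = stack3 (mat 1) (- mat 1) 0,
     recourse_mat = stack3 0 (- 0) W_ex,
     rhs = (\<lambda>\<xi>. stack3 1 (- 1) (b_ex - H_ex *v \<xi>)),
     unc_set = \<Xi>_ex,
     law = P \<rparr>"

end

theory Submission
  imports Defs
begin

text \<open>
  The first two blocks of constraints force \<open>x = 1\<close>, so the whole example is about the second
  stage. There the two rows of \<open>W\<close> equal to \<open>1\<close> bound \<open>y\<close> from below and the two rows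
  equal to \<open>-1\<close> bound it from above by linear functions of \<open>\<xi>\<close>. Every lower bound lies below every
  upper bound on the second-order cone \<open>\<parallel>(\<xi>\<^sub>1, \<xi>\<^sub>2)\<parallel> \<le> \<xi>\<^sub>3\<close>, which contains \<open>\<Xi>\<close>; hence
  \<open>x = 1\<close> satisfies A4a (lemma \<open>ex_A4a_at_1\<close>). As the recourse cost is zero, the
  objective is \<open>c \<bullet> 1\<close> at \<open>x = 1\<close>, and it is \<open>\<infinity>\<close> at all infeasible \<open>x\<close>
  (lemma \<open>objective_ex\<close>). So \<open>1\<close> is the only optimal decision, which gives A2 and A3.

  A4b fails at the vertex \<open>0\<close>. All four bounds vanish there, so an affine policy that is feasible near \<open>0\<close>
  is linear, and as the bounds are homogeneous it stays feasible at all of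
  \<open>p\<^sub>1, \<dots>, p\<^sub>7\<close>. A linear policy \<open>y\<close> is then
  over-determined: the chords \<open>p\<^sub>3 - p\<^sub>6\<close> and \<open>p\<^sub>4 - p\<^sub>5\<close> are parallel to the second axis, and
  the lower bound at \<open>p\<^sub>3\<close> and upper bound at \<open>p\<^sub>6\<close> prescribe a larger slope along that axis
  than the upper bound at \<open>p\<^sub>4\<close> and lower bound at \<open>p\<^sub>5\<close> permit
  (lemma \<open>no_linear_policy\<close>).

  The general implication is refuted by the instance whose law is the point mass at \<open>0\<close>.
\<close>

section \<open>The second stage in scalar form\<close>

text \<open>These are the rows of \<open>W y \<ge> b - H \<xi>\<close> for the one component \<open>t\<close> of \<open>y\<close>.\<close>

definition second_stage_ok :: "real^3 \<Rightarrow> real \<Rightarrow> bool" where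
  "second_stage_ok \<xi> t \<longleftrightarrow>
     t + (\<xi> $ 1 + 2 * \<xi> $ 2 + \<xi> $ 3) \<ge> 0 \<and>
     t + (\<xi> $ 1 - 2 * \<xi> $ 2 + 3 * \<xi> $ 3) \<ge> 0 \<and>
     - t + (2 * \<xi> $ 1 - 2 * \<xi> $ 2 + 2 * \<xi> $ 3) \<ge> 0 \<and>
     - t + (- \<xi> $ 1 + 2 * \<xi> $ 2 + 3 * \<xi> $ 3) \<ge> 0"

lemma stack3_mult_vec: "stack3 A B C *v x = stack3 (A *v x) (B *v x) (C *v x)"
  by (simp add: vec_eq_iff stack3_def matrix_vector_mult_def split: sum.split)

lemma stack3_add: "stack3 u v w + stack3 u' v' w' = stack3 (u + u') (v + v') (w + w')"
  by (simp add: vec_eq_iff stack3_def split: sum.split)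

lemma stack3_scaleR: "r *\<^sub>R stack3 u v w = stack3 (r *\<^sub>R u) (r *\<^sub>R v) (r *\<^sub>R w)"
  by (simp add: vec_eq_iff stack3_def split: sum.split)

lemma stack3_mono_iff:
  "stack3 u v w \<le> stack3 u' v' w' \<longleftrightarrow> u \<le> u' \<and> v \<le> v' \<and> w \<le> w'"
  by (auto simp: less_eq_vec_def stack3_def split_sum_all)

lemma vector_4:
  "(vector [w, x, y, z] :: 'a::zero^4) $ 1 = w" "(vector [w, x, y, z] :: 'a^4) $ 2 = x"
  "(vector [w, x, y, z] :: 'a^4) $ 3 = y" "(vector [w, x, y, z] :: 'a^4) $ 4 = z"
  by (simp_all add: vector_def)

lemma example_slp_sel:
  "unc_set (example_slp c P) = \<Xi>_ex" "law (example_slp c P) = P"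
  "first_cost (example_slp c P) = c" "second_cost (example_slp c P) = 0"
  by (simp_all add: example_slp_def)

lemma recourse_feasible_ex_iff:
  "recourse_feasible (example_slp c P) x \<xi> y \<longleftrightarrow> x = 1 \<and> second_stage_ok \<xi> (y $ 1)"
proof -
  have W: "b_ex - H_ex *v \<xi> \<le> W_ex *v y \<longleftrightarrow> second_stage_ok \<xi> (y $ 1)"
    unfolding less_eq_vec_def forall_4 second_stage_ok_def
    by (simp add: b_ex_def H_ex_def W_ex_def matrix_vector_mult_def sum_3 vector_3 vector_4
        vector_1 algebra_simps)
       linarith
  have "- mat 1 *v x = - x"
    by (simp add: matrix_vector_mult_def vec_eq_iff sum_negf mat_def if_distrib if_distribR
        cong: if_cong)
  then show ?thesis
    by (auto simp: recourse_feasible_def example_slp_def stack3_mult_vec stack3_add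
        stack3_mono_iff W)
qed

lemma second_stage_ok_zero: "second_stage_ok 0 t \<longleftrightarrow> t = 0"
  by (auto simp: second_stage_ok_def)

lemma second_stage_ok_scaleR:
  assumes "r > 0"
  shows "second_stage_ok (r *\<^sub>R \<xi>) (r * t) \<longleftrightarrow> second_stage_ok \<xi> t"
proof -
  have "0 \<le> r * t + z \<longleftrightarrow> 0 \<le> t + z / r" "0 \<le> - (r * t) + z \<longleftrightarrow> 0 \<le> - t + z / r" for z
    using assms by (simp_all add: field_simps)
  then show ?thesis
    using assms by (simp add: second_stage_ok_def add_divide_distrib diff_divide_distrib)
qed

section \<open>Feasibility on the whole support\<close>

text \<open>These are the half-spaces containing the second-order cone, so the hypothesis on \<open>u\<close>, \<open>v\<close>
  and \<open>w\<close> is what Cauchy-Schwarz needs at the points \<open>(cos \<theta>, sin \<theta>, 1)\<close>.\<close>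

lemma \<Xi>_ex_halfspace:
  assumes "\<xi> \<in> \<Xi>_ex" and w: "w \<ge> 0" and uvw: "u\<^sup>2 + v\<^sup>2 \<le> w\<^sup>2"
  shows "u * \<xi> $ 1 + v * \<xi> $ 2 + w * \<xi> $ 3 \<ge> 0"
proof -
  let ?a = "vector [u, v, w] :: real^3"
  have inner: "?a \<bullet> z = u * z $ 1 + v * z $ 2 + w * z $ 3" for z
    by (simp add: inner_vec_def sum_3 vector_3)
  have circle: "u * cos t + v * sin t + w \<ge> 0" for t
  proof -
    have "(u * cos t + v * sin t)\<^sup>2 + (u * sin t - v * cos t)\<^sup>2
        = (u\<^sup>2 + v\<^sup>2) * ((cos t)\<^sup>2 + (sin t)\<^sup>2)"
      by algebra
    then have "(u * cos t + v * sin t)\<^sup>2 + (u * sin t - v * cos t)\<^sup>2 = u\<^sup>2 + v\<^sup>2"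
      by simp
    then have "(u * cos t + v * sin t)\<^sup>2 \<le> w\<^sup>2"
      using uvw zero_le_power2[of "u * sin t - v * cos t"] by linarith
    then have "\<bar>u * cos t + v * sin t\<bar> \<le> w"
      using w abs_le_square_iff[of "u * cos t + v * sin t" w] by simp
    then show ?thesis by linarith
  qed
  have "\<Xi>_ex \<subseteq> {z. ?a \<bullet> z \<ge> 0}"
    unfolding \<Xi>_ex_def
  proof (rule hull_minimal)
    show "insert 0 (p_ex ` {1..7}) \<subseteq> {z. ?a \<bullet> z \<ge> 0}"
      using circle by (auto simp: inner p_ex_def vector_3)
  qed (rule convex_halfspace_ge)
  then show ?thesis using assms(1) by (auto simp: inner)
qed

lemma ex_second_stage_ok:
  assumes "\<xi> \<in> \<Xi>_ex"
  shows "\<exists>t. second_stage_ok \<xi> t"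
proof
  \<comment> \<open>The larger lower bound works: the four differences between an upper and a lower bound are
     the four linear forms below, whose half-spaces contain \<open>\<Xi>_ex\<close>.\<close>
  let ?t = "max (- (\<xi> $ 1 + 2 * \<xi> $ 2 + \<xi> $ 3)) (- (\<xi> $ 1 - 2 * \<xi> $ 2 + 3 * \<xi> $ 3))"
  show "second_stage_ok \<xi> ?t"
    using \<Xi>_ex_halfspace[OF assms, of 3 3 0] \<Xi>_ex_halfspace[OF assms, of 4 0 4]
      \<Xi>_ex_halfspace[OF assms, of 5 3 "- 4"] \<Xi>_ex_halfspace[OF assms, of 6 0 0]
    unfolding second_stage_ok_def by (auto simp: max_def)
qed

section \<open>Recourse value and objective\<close>

lemma recourse_value_ex:
  "recourse_value (example_slp c P) x \<xi> = (if x = 1 \<and> (\<exists>t. second_stage_ok \<xi> t) then 0 else \<infinity>)"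
proof -
  have "(\<exists>t. second_stage_ok \<xi> t) \<longleftrightarrow> (\<exists>y :: real^1. second_stage_ok \<xi> (y $ 1))"
    by (metis vec_component)
  then show ?thesis
    by (auto simp: example_slp_sel recourse_value_def recourse_feasible_ex_iff top_ereal_def zero_ereal_def)
qed

lemma ex_A4a_at_1: "A4a_at (example_slp c P) 1"
  using ex_second_stage_ok by (auto simp: A4a_at_def recourse_value_ex example_slp_sel)

lemma objective_ex:
  assumes "prob_space P" and AE: "AE \<xi> in P. \<xi> \<in> \<Xi>_ex"
  shows "objective (example_slp c P) x = (if x = 1 then ereal (c \<bullet> 1) else \<infinity>)"
proof -
  interpret prob_space P by fact
  let ?Q = "recourse_value (example_slp c P) x"
  have neg: "e2ennreal (- ?Q \<xi>) = 0" for \<xi>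
    by (simp add: recourse_value_ex e2ennreal_neg)
  have pos: "(\<integral>\<^sup>+ \<xi>. e2ennreal (?Q \<xi>) \<partial>P) = (if x = 1 then 0 else \<infinity>)"
  proof (cases "x = 1")
    case True
    have "AE \<xi> in P. e2ennreal (?Q \<xi>) = 0"
      using AE by eventually_elim (auto simp: recourse_value_ex True dest: ex_second_stage_ok)
    then have "(\<integral>\<^sup>+ \<xi>. e2ennreal (?Q \<xi>) \<partial>P) = (\<integral>\<^sup>+ \<xi>. 0 \<partial>P)"
      by (rule nn_integral_cong_AE)
    then show ?thesis by (simp add: True)
  next
    case False
    then show ?thesis
      by (simp add: recourse_value_ex emeasure_space_1)
  qed
  show ?thesis
    unfolding objective_def ereal_expectation_def example_slp_sel neg pos by simp
qed

section \<open>No affine policy near the vertex 0\<close>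

text \<open>The points \<open>p_ex j\<close> all lie in the plane \<open>\<xi>\<^sub>3 = 1\<close>, which misses \<open>0\<close>.\<close>

lemma zero_extreme_point: "0 extreme_point_of \<Xi>_ex"
proof -
  have "convex hull (p_ex ` {1..7}) \<subseteq> {z. axis 3 1 \<bullet> z = 1}"
  proof (rule hull_minimal)
    show "p_ex ` {1..7} \<subseteq> {z. axis 3 1 \<bullet> z = 1}"
      by (auto simp: p_ex_def inner_axis' vector_3)
  qed (rule convex_hyperplane)
  then have "0 \<notin> convex hull (p_ex ` {1..7})"
    by auto
  then show ?thesis
    unfolding \<Xi>_ex_def by (intro extreme_point_of_convex_hull_insert) auto
qed

text \<open>Writing \<open>p\<^sub>3, \<dots>, p\<^sub>6\<close> through the one angle \<open>3 \<pi> / 7\<close> turns the comparison of two slopes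
  into a single inequality between its sine and its cosine.\<close>

lemma p_ex_coords:
  defines "c \<equiv> cos (3 * pi / 7)" and "s \<equiv> sin (3 * pi / 7)"
  shows "p_ex 3 = vector [- c, s, 1]"
    and "p_ex 4 = vector [2 * c\<^sup>2 - 1, 2 * s * c, 1]"
    and "p_ex 5 = vector [2 * c\<^sup>2 - 1, - (2 * s * c), 1]"
    and "p_ex 6 = vector [- c, - s, 1]"
proof -
  have t: "\<theta>_ex 3 = pi - 3 * pi / 7" "\<theta>_ex 4 = 2 * (3 * pi / 7)"
    "\<theta>_ex 5 = 2 * pi - 2 * (3 * pi / 7)" "\<theta>_ex 6 = 3 * pi / 7 + pi"
    by (simp_all add: \<theta>_ex_def field_simps)
  show "p_ex 3 = vector [- c, s, 1]" "p_ex 6 = vector [- c, - s, 1]"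
    unfolding p_ex_def t c_def s_def by (simp_all only: cos_pi_minus sin_pi_minus cos_periodic_pi sin_periodic_pi)
  show "p_ex 4 = vector [2 * c\<^sup>2 - 1, 2 * s * c, 1]"
    unfolding p_ex_def t c_def s_def by (simp only: cos_double_cos sin_double)
  show "p_ex 5 = vector [2 * c\<^sup>2 - 1, - (2 * s * c), 1]"
    unfolding p_ex_def t c_def s_def
    by (simp only: cos_2pi_minus sin_2pi_minus cos_double_cos sin_double)
qed

text \<open>As \<open>3 \<pi> / 7\<close> is close to \<open>\<pi> / 2\<close>, its cosine \<open>sin (\<pi> / 14)\<close> is less than \<open>\<pi> / 14\<close>,
  and the sine is then bounded below by its square.\<close>

lemma cos_sin_3pi_7:
  shows "cos (3 * pi / 7) > 0" and "6 + 3 * cos (3 * pi / 7) < 8 * sin (3 * pi / 7)"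
proof -
  let ?c = "cos (3 * pi / 7)" and ?s = "sin (3 * pi / 7)"
  show c0: "?c > 0"
    by (rule cos_gt_zero) auto
  have "?c = sin (pi / 14)"
    unfolding sin_cos_eq by (simp add: field_simps)
  also have "\<dots> \<le> pi / 14"
    by (rule sin_x_le_x) simp
  also have "\<dots> < 1/4"
    using pi_less_4 pi_approx by simp
  finally have c1: "?c < 1/4" .
  have s0: "?s \<ge> 0"
    by (rule sin_ge_zero) auto
  have "?c * ?c \<le> (1/4) * (1/4)"
    using c0 c1 by (intro mult_mono) auto
  then have "?s\<^sup>2 \<ge> 15/16"
    using sin_cos_squared_add[of "3 * pi / 7"] by (simp add: power2_eq_square)
  moreover have "?s\<^sup>2 \<le> ?s"
    using s0 by (simp add: power2_eq_square mult_left_le)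
  ultimately show "6 + 3 * ?c < 8 * ?s"
    using c1 by linarith
qed

text \<open>Adding the second lower bound at \<open>p\<^sub>3\<close> to the second upper bound at \<open>p\<^sub>6\<close>, and the first
  upper bound at \<open>p\<^sub>4\<close> to the first lower bound at \<open>p\<^sub>5\<close>, leaves in each sum the value of \<open>f\<close> on
  the second axis as the only unknown; the two resulting bounds on it are incompatible.\<close>

lemma no_linear_policy:
  assumes "linear f" and ok: "\<And>j. j \<in> {1..7} \<Longrightarrow> second_stage_ok (p_ex j) (f (p_ex j))"
  shows False
proof -
  let ?c = "cos (3 * pi / 7)" and ?s = "sin (3 * pi / 7)"
  interpret linear f by fact
  define a where "a = (\<lambda>i. f (axis i 1))"
  have f: "f z = z $ 1 * a 1 + z $ 2 * a 2 + z $ 3 * a 3" for z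
  proof -
    have "f z = f (\<Sum>i\<in>UNIV. z $ i *\<^sub>R axis i 1)"
      using basis_expansion[of z] by (simp add: scalar_mult_eq_scaleR)
    then show ?thesis
      by (simp add: add scale sum_3 a_def)
  qed
  have 3: "- ?c * a 1 + ?s * a 2 + a 3 + (- ?c - 2 * ?s + 3) \<ge> 0"
    using ok[of 3] unfolding f second_stage_ok_def p_ex_coords by (simp add: vector_3)
  have 6: "?c * a 1 + ?s * a 2 - a 3 + (?c - 2 * ?s + 3) \<ge> 0"
    using ok[of 6] unfolding f second_stage_ok_def p_ex_coords by (simp add: vector_3)
  have 4: "- ((2 * ?c\<^sup>2 - 1) * a 1 + 2 * ?s * ?c * a 2 + a 3)
      + (2 * (2 * ?c\<^sup>2 - 1) - 2 * (2 * ?s * ?c) + 2) \<ge> 0"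
    using ok[of 4] unfolding f second_stage_ok_def p_ex_coords by (simp add: vector_3)
  have 5: "(2 * ?c\<^sup>2 - 1) * a 1 - 2 * ?s * ?c * a 2 + a 3
      + ((2 * ?c\<^sup>2 - 1) - 2 * (2 * ?s * ?c) + 1) \<ge> 0"
    using ok[of 5] unfolding f second_stage_ok_def p_ex_coords by (simp add: vector_3)
  have lower: "2 * ?s * a 2 - 4 * ?s + 6 \<ge> 0"
    using 3 6 by linarith
  have "2 * ?c * (- (2 * ?s * a 2) + 3 * ?c - 4 * ?s) \<ge> 0"
    using 4 5 by (simp add: algebra_simps power2_eq_square)
  then have "- (2 * ?s * a 2) + 3 * ?c - 4 * ?s \<ge> 0"
    using cos_sin_3pi_7(1) by (simp add: zero_le_mult_iff)
  with lower cos_sin_3pi_7(2) show False by linarith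
qed

lemma not_A4b_at_ex: "\<not> A4b_at (example_slp c P) x"
proof
  assume "A4b_at (example_slp c P) x"
  then obtain \<epsilon> y where "\<epsilon> > 0" and y: "affine_map y"
    and "\<forall>\<zeta>\<in>\<Xi>_ex \<inter> ball 0 \<epsilon>. recourse_feasible (example_slp c P) x \<zeta> (y \<zeta>)"
    using zero_extreme_point unfolding A4b_at_def example_slp_sel by blast
  then have feas: "second_stage_ok \<zeta> (y \<zeta> $ 1)" if "\<zeta> \<in> \<Xi>_ex" "norm \<zeta> < \<epsilon>" for \<zeta>
    using that by (auto simp: recourse_feasible_ex_iff)
  obtain g a where "linear g" and y_eq: "\<And>z. y z = g z + a"
    using y by (auto simp: affine_map_def)
  interpret linear g by fact
  have in_\<Xi>: "0 \<in> \<Xi>_ex" "\<And>j. j \<in> {1..7} \<Longrightarrow> p_ex j \<in> \<Xi>_ex"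
    by (auto simp: \<Xi>_ex_def intro!: hull_inc)
  have "a $ 1 = 0"
    using feas[of 0] in_\<Xi> \<open>\<epsilon> > 0\<close> by (simp add: second_stage_ok_zero y_eq zero)
  have "second_stage_ok (p_ex j) (g (p_ex j) $ 1)" if j: "j \<in> {1..7}" for j
  proof -
    \<comment> \<open>Shrinking \<open>p_ex j\<close> towards the vertex \<open>0\<close> enters the ball without leaving \<open>\<Xi>_ex\<close>.\<close>
    define r where "r = min 1 (\<epsilon> / (norm (p_ex j) + 1))"
    have d: "norm (p_ex j) + 1 > 0"
      by (simp add: add_nonneg_pos)
    then have r: "0 < r" "r \<le> 1"
      using \<open>\<epsilon> > 0\<close> by (auto simp: r_def)
    have "r * (norm (p_ex j) + 1) \<le> \<epsilon>"
      using d by (simp add: r_def flip: pos_le_divide_eq)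
    then have "norm (r *\<^sub>R p_ex j) < \<epsilon>"
      using r by (simp add: algebra_simps)
    moreover have "r *\<^sub>R p_ex j \<in> \<Xi>_ex"
      using convexD_alt[of \<Xi>_ex 0 "p_ex j" r] in_\<Xi> j r by (simp add: \<Xi>_ex_def convex_convex_hull)
    ultimately have "second_stage_ok (r *\<^sub>R p_ex j) (r * g (p_ex j) $ 1)"
      using feas[of "r *\<^sub>R p_ex j"] \<open>a $ 1 = 0\<close> by (simp add: y_eq scale)
    then show ?thesis
      using second_stage_ok_scaleR r(1) by blast
  qed
  moreover have "linear (\<lambda>z. g z $ 1)"
    by (intro linearI) (simp_all add: add scale)
  ultimately show False
    using no_linear_policy by blast
qed

section \<open>The example as a counterexample\<close>

lemma two_stage_slp_ex:
  assumes "prob_space P" "sets P = sets borel" "AE \<xi> in P. \<xi> \<in> \<Xi>_ex"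
  shows "two_stage_slp (example_slp c P)"
proof -
  have "linear (\<lambda>\<xi>. stack3 (0 :: real^'n) (0 :: real^'n) (- (H_ex *v \<xi>)))"
    by (intro linearI)
       (simp_all add: stack3_add stack3_scaleR matrix_vector_right_distrib
          matrix_vector_mult_scaleR)
  moreover have "stack3 1 (- 1) (b_ex - H_ex *v \<xi>)
      = stack3 (0 :: real^'n) (0 :: real^'n) (- (H_ex *v \<xi>)) + stack3 1 (- 1) b_ex" for \<xi>
    by (simp add: stack3_add)
  ultimately have "affine_map (rhs (example_slp c P))"
    unfolding affine_map_def example_slp_def two_stage_lp.simps by blast
  moreover have "polyhedron \<Xi>_ex"
    unfolding \<Xi>_ex_def by (intro polytope_imp_polyhedron polytope_convex_hull) auto
  ultimately show ?thesis
    using assms unfolding two_stage_slp_def example_slp_sel by blast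
qed

lemma A2_A3_ex:
  assumes "prob_space P" "AE \<xi> in P. \<xi> \<in> \<Xi>_ex" "integrable P norm"
  shows "A2 (example_slp c P)" and "A3 (example_slp c P)"
proof -
  note obj = objective_ex[OF assms(1,2), of c]
  have opt: "optimal_value (example_slp c P) = ereal (c \<bullet> 1)"
    unfolding optimal_value_def obj by (subst cInf_eq_minimum[where z = "ereal (c \<bullet> 1)"]) auto
  show "A2 (example_slp c P)"
    using assms(3) by (simp add: A2_def opt example_slp_sel)
  have "optimal_decisions (example_slp c P) = {1}"
    by (auto simp: optimal_decisions_def obj opt split: if_splits)
  then show "A3 (example_slp c P)"
    by (simp add: A3_def)
qed

theorem corollary2:
  shows "(\<forall>(c :: real^'n) (P :: (real^3) measure).
            prob_space P \<and> sets P = sets borel \<and> (AE \<xi> in P. \<xi> \<in> \<Xi>_ex) \<and> integrable P norm \<longrightarrow>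
              two_stage_slp (example_slp c P) \<and>
              A2 (example_slp c P) \<and> A3 (example_slp c P) \<and> A4a (example_slp c P) \<and>
              \<not> A4b (example_slp c P)) \<and>
         \<not> (\<forall>S :: ('n::finite, 1, 3, 'n + 'n + 4) two_stage_lp.
               two_stage_slp S \<and> A2 S \<and> A3 S \<and> A4a S \<longrightarrow> A4b S)"
    (is "?example \<and> \<not> ?implication")
proof
  show example: ?example
    using two_stage_slp_ex A2_A3_ex ex_A4a_at_1 not_A4b_at_ex
    unfolding A4a_def A4b_def by blast
  let ?P = "return borel 0 :: (real^3) measure"
  have "prob_space ?P"
    by (rule prob_space_return) simp
  moreover have "AE \<xi> in ?P. \<xi> \<in> \<Xi>_ex"
  proof -
    have "closed \<Xi>_ex"
      unfolding \<Xi>_ex_def by (intro compact_imp_closed finite_imp_compact_convex_hull) auto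
    moreover have "0 \<in> \<Xi>_ex"
      by (simp add: \<Xi>_ex_def hull_inc)
    ultimately show ?thesis
      by (subst AE_return) (auto simp: pred_def intro: borel_closed)
  qed
  moreover have "integrable ?P norm"
    by (simp add: integrable_iff_bounded nn_integral_return)
  ultimately show "\<not> ?implication"
    using example[rule_format, of ?P 0] by auto
qed

end
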